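(* For every $N\ge1$, the prefix tree for $\mathrm{Av}_N(231)$ is isomorphic to the prefix tree for $\mathrm{Av}_N(132)$: there is a bijection $\Phi$ from the set of prefixes for $\mathrm{Av}_N(231)$ to the set of prefixes for $\mathrm{Av}_N(132)$ which preserves the tree structure (i.e. $p$ is a prefix flattening of $q$ if and only if $\Phi(p)$ is a prefix flattening of $\Phi(q)$) and preserves strike probabilities, $S_N(\Phi(p))=S_N(p)$ as pairs of integers.
   Context: For a pattern $\rho$ (a permutation of $[M]$), $\mathrm{Av}_N(\rho)$ is the set of permutations $\pi=\pi_1\cdots\pi_N$ of $[N]$ with no subsequence $\pi_{i_1}\cdots\pi_{i_M}$ ($i_1<\dots<i_M$) in the same relative order as $\rho$. The $i$th prefix flattening $\pi|_{[i]}$ is the permutation of $[i]$ in the same relative order as $\pi_1,\dots,\pi_i$. For a set $I_N$ of permutations of $[N]$, a prefix is a permutation $p$ of $[k]$, $1\le k\le N$, with $p=\pi|_{[k]}$ for some $\pi\in I_N$; a prefix $q$ has $p$ (of size $k$) as a prefix flattening if $q|_{[k]}=p$; the prefix tree is the set of prefixes ordered by this relation. The strike probability of a prefix $p$ of size $k$ is the pair of integers $S_N(p)=\big(\#\{\pi\in I_N:\pi|_{[k]}=p,\ \pi_k=N\},\ \#\{\pi\in I_N:\pi|_{[k]}=p\}\big)$. *)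

theory Defs
  imports "HOL-Library.Sublist" "HOL-Combinatorics.Multiset_Permutations"
begin

text \<open>
  A permutation \<open>\<pi>\<^sub>1\<dots>\<pi>\<^sub>N\<close> of \<open>[N] = {1,\<dots>,N}\<close> is its one-line notation, a list over \<^typ>\<open>nat\<close>.
  List positions start at 0, so \<open>\<pi>\<^sub>k\<close> is \<open>\<pi> ! (k - 1)\<close>.
\<close>

abbreviation perms :: "nat \<Rightarrow> nat list set" where
  "perms n \<equiv> permutations_of_set {1..n}"

definition same_order :: "nat list \<Rightarrow> nat list \<Rightarrow> bool" where
  "same_order xs ys \<longleftrightarrow> length xs = length ys \<and>
     (\<forall>i<length xs. \<forall>j<length xs. xs ! i < xs ! j \<longleftrightarrow> ys ! i < ys ! j)"

definition Av :: "nat \<Rightarrow> nat list \<Rightarrow> nat list set" where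
  "Av N \<rho> = {\<pi> \<in> perms N. \<not> (\<exists>s. subseq s \<pi> \<and> same_order s \<rho>)}"

text \<open>\<open>\<pi>|\<^bsub>[k]\<^esub>\<close>; meaningful only if \<open>k \<le> length \<pi>\<close>, see \<open>prefix_flattening_ex1\<close> below.\<close>

definition prefix_flattening :: "nat list \<Rightarrow> nat \<Rightarrow> nat list" where
  "prefix_flattening \<pi> k = (THE \<sigma>. \<sigma> \<in> perms k \<and> same_order \<sigma> (take k \<pi>))"

definition perm_prefixes :: "nat \<Rightarrow> nat list set \<Rightarrow> nat list set" where
  "perm_prefixes N I = {p. \<exists>k. 1 \<le> k \<and> k \<le> N \<and> p \<in> perms k \<and> (\<exists>\<pi>\<in>I. p = prefix_flattening \<pi> k)}"

text \<open>The length guard excludes the values of \<^const>\<open>prefix_flattening\<close> that are unspecified.\<close>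

definition is_prefix_flattening :: "nat list \<Rightarrow> nat list \<Rightarrow> bool" where
  "is_prefix_flattening p q \<longleftrightarrow> length p \<le> length q \<and> prefix_flattening q (length p) = p"

definition strike :: "nat \<Rightarrow> nat list set \<Rightarrow> nat list \<Rightarrow> nat \<times> nat" where
  "strike N I p =
     (card {\<pi> \<in> I. prefix_flattening \<pi> (length p) = p \<and> \<pi> ! (length p - 1) = N},
      card {\<pi> \<in> I. prefix_flattening \<pi> (length p) = p})"

lemma perms_iff: "\<sigma> \<in> perms k \<longleftrightarrow> set \<sigma> = {1..k} \<and> distinct \<sigma>"
  by (simp add: permutations_of_set_def)

lemma perms_length: "\<sigma> \<in> perms k \<Longrightarrow> length \<sigma> = k"
  using distinct_card[of \<sigma>] permutations_of_setD[of \<sigma> "{1..k}"] by simp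

lemma perms_nth_eq_card:
  assumes "\<sigma> \<in> perms k" "i < k"
  shows "\<sigma> ! i = Suc (card {j. j < k \<and> \<sigma> ! j < \<sigma> ! i})"
proof -
  have l: "length \<sigma> = k" and d: "distinct \<sigma>" and s: "set \<sigma> = {1..k}"
    using perms_length[OF assms(1)] permutations_of_setD[OF assms(1)] by auto
  have i: "\<sigma> ! i \<in> {1..k}" using nth_mem[of i \<sigma>] s l assms(2) by simp
  have "(!) \<sigma> ` {j. j < k \<and> \<sigma> ! j < \<sigma> ! i} = {x \<in> set \<sigma>. x < \<sigma> ! i}"
    using l by (auto simp: in_set_conv_nth)
  also have "\<dots> = {1..<\<sigma> ! i}" using s i by auto
  finally have im: "(!) \<sigma> ` {j. j < k \<and> \<sigma> ! j < \<sigma> ! i} = {1..<\<sigma> ! i}" .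
  have "inj_on ((!) \<sigma>) {j. j < k \<and> \<sigma> ! j < \<sigma> ! i}"
    using d l by (auto simp: inj_on_def nth_eq_iff_index_eq)
  from card_image[OF this] im i show ?thesis by auto
qed

lemma same_order_unique:
  assumes "\<sigma> \<in> perms k" "\<tau> \<in> perms k" "same_order \<sigma> xs" "same_order \<tau> xs"
  shows "\<sigma> = \<tau>"
proof (rule nth_equalityI)
  show "length \<sigma> = length \<tau>" using perms_length[OF assms(1)] perms_length[OF assms(2)] by simp
  fix i assume "i < length \<sigma>"
  then have i: "i < k" using perms_length[OF assms(1)] by simp
  have "\<sigma> ! j < \<sigma> ! i \<longleftrightarrow> \<tau> ! j < \<tau> ! i" if "j < k" for j
    using assms(3,4) i that perms_length[OF assms(1)] perms_length[OF assms(2)]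
    by (simp add: same_order_def)
  then have "{j. j < k \<and> \<sigma> ! j < \<sigma> ! i} = {j. j < k \<and> \<tau> ! j < \<tau> ! i}"
    by auto
  then show "\<sigma> ! i = \<tau> ! i"
    using perms_nth_eq_card[OF assms(1) i] perms_nth_eq_card[OF assms(2) i] by simp
qed

lemma prefix_flattening_ex1:
  assumes "distinct \<pi>" "k \<le> length \<pi>"
  shows "\<exists>!\<sigma>. \<sigma> \<in> perms k \<and> same_order \<sigma> (take k \<pi>)"
proof -
  define xs where "xs = take k \<pi>"
  have l: "length xs = k" and d: "distinct xs" using assms by (auto simp: xs_def)
  define r where "r x = card {y \<in> set xs. y \<le> x}" for x
  have r: "r x < r y \<longleftrightarrow> x < y" if "x \<in> set xs" "y \<in> set xs" for x y
  proof -
    have *: "r x < r y" if "x < y" "y \<in> set xs" for x y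
      unfolding r_def
      using that by (intro psubset_card_mono) (auto dest: leD intro!: psubsetI)
    from * that show ?thesis by (metis less_asym less_irrefl linorder_neqE)
  qed
  have inj: "inj_on r (set xs)"
    using r by (metis inj_onI less_irrefl linorder_neqE)
  have sub: "r ` set xs \<subseteq> {1..k}"
  proof
    fix z assume "z \<in> r ` set xs"
    then obtain x where x: "x \<in> set xs" "z = r x" by auto
    have "r x \<le> card (set xs)" unfolding r_def by (intro card_mono) auto
    moreover have "0 < r x" unfolding r_def using x by (subst card_gt_0_iff) auto
    ultimately show "z \<in> {1..k}" using x d l by (simp add: distinct_card)
  qed
  have "r ` set xs = {1..k}"
    using sub card_image[OF inj] d l by (intro card_subset_eq) (auto simp: distinct_card)
  then have "map r xs \<in> perms k" using inj d unfolding perms_iff by (simp add: distinct_map)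
  moreover have "same_order (map r xs) xs" by (auto simp: same_order_def r)
  ultimately show ?thesis using same_order_unique[of _ k _ xs] unfolding xs_def[symmetric] by metis
qed

end

theory Submission
  imports Defs
begin

text \<open>
  Both classes grow by appending a last entry, and both follow the same generating rule: there is a
  label such that a permutation with label \<open>b\<close> has exactly one child of each label \<open>0, \<dots>, b + 1\<close>.
  For 231 the label counts the earlier entries exceeding the last one; for 132 it counts the ways to
  write the permutation as a skew sum of two parts. A node is thus determined by the labels on the path
  leading to it, and matching these label sequences is a tree isomorphism. In both classes a label is
  \<open>0\<close> exactly if the last entry is the maximum, so \<open>\<pi>\<^sub>k = N\<close> means that the last
  \<open>0\<close> in the label sequence of \<open>\<pi>\<close> is at place \<open>k\<close>; hence strike probabilities agree as well.
\<close>

declare One_nat_def [simp del]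

section \<open>Order isomorphism, permutations and prefix flattenings\<close>

lemma same_order_sym: "same_order xs ys \<Longrightarrow> same_order ys xs"
  by (simp add: same_order_def)

lemma same_order_trans: "same_order xs ys \<Longrightarrow> same_order ys zs \<Longrightarrow> same_order xs zs"
  by (simp add: same_order_def)

lemma same_order_take: "same_order xs ys \<Longrightarrow> same_order (take k xs) (take k ys)"
  by (auto simp: same_order_def)

lemma same_order_nth_less_iff:
  "same_order xs ys \<Longrightarrow> i < length ys \<Longrightarrow> j < length ys \<Longrightarrow> xs ! i < xs ! j \<longleftrightarrow> ys ! i < ys ! j"
  by (simp add: same_order_def)

lemma perms_distinct: "\<sigma> \<in> perms k \<Longrightarrow> distinct \<sigma>"
  by (simp add: perms_iff)

lemma permsI:
  assumes "distinct xs" "set xs \<subseteq> {1..k}" "length xs = k"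
  shows "xs \<in> perms k"
  unfolding perms_iff using assms distinct_card[OF assms(1)] by (simp add: card_subset_eq)

lemma perms_nth_bounds: "\<sigma> \<in> perms k \<Longrightarrow> i < k \<Longrightarrow> 1 \<le> \<sigma> ! i \<and> \<sigma> ! i \<le> k"
  using nth_mem[of i \<sigma>] perms_length[of \<sigma> k] by (auto simp: perms_iff)

lemma perms_nth_eq_iff: "\<sigma> \<in> perms k \<Longrightarrow> i < k \<Longrightarrow> j < k \<Longrightarrow> \<sigma> ! i = \<sigma> ! j \<longleftrightarrow> i = j"
  using perms_length perms_distinct nth_eq_iff_index_eq by metis

lemma perms_obtain_nth:
  assumes "\<sigma> \<in> perms k" "1 \<le> v" "v \<le> k"
  obtains i where "i < k" "\<sigma> ! i = v"
proof -
  have "v \<in> set \<sigma>" using assms by (auto simp: perms_iff)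
  with that show ?thesis using perms_length[OF assms(1)] by (auto simp: in_set_conv_nth)
qed

lemma prefix_flattening_iff:
  assumes "\<pi> \<in> perms n" "k \<le> n"
  shows "prefix_flattening \<pi> k = \<sigma> \<longleftrightarrow> \<sigma> \<in> perms k \<and> same_order \<sigma> (take k \<pi>)"
proof -
  have "\<exists>!\<sigma>. \<sigma> \<in> perms k \<and> same_order \<sigma> (take k \<pi>)"
    using assms perms_length[OF assms(1)] perms_distinct[OF assms(1)]
    by (intro prefix_flattening_ex1) auto
  then show ?thesis
    unfolding prefix_flattening_def by (metis (mono_tags, lifting) theI')
qed

lemma prefix_flattening_perms:
  "\<pi> \<in> perms n \<Longrightarrow> k \<le> n \<Longrightarrow> prefix_flattening \<pi> k \<in> perms k"
  using prefix_flattening_iff by blast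

lemma prefix_flattening_same_order:
  "\<pi> \<in> perms n \<Longrightarrow> k \<le> n \<Longrightarrow> same_order (prefix_flattening \<pi> k) (take k \<pi>)"
  using prefix_flattening_iff by blast

lemma prefix_flattening_self: "\<pi> \<in> perms n \<Longrightarrow> prefix_flattening \<pi> n = \<pi>"
  using prefix_flattening_iff[of \<pi> n n \<pi>] perms_length[of \<pi> n] by (simp add: same_order_def)

lemma prefix_flattening_prefix_flattening:
  assumes "\<pi> \<in> perms n" "k \<le> n" "j \<le> k"
  shows "prefix_flattening (prefix_flattening \<pi> k) j = prefix_flattening \<pi> j"
proof -
  have "same_order (take j (prefix_flattening \<pi> k)) (take j (take k \<pi>))"
    by (rule same_order_take[OF prefix_flattening_same_order[OF assms(1,2)]])
  then have *: "same_order (take j (prefix_flattening \<pi> k)) (take j \<pi>)"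
    using assms by (simp add: min_def)
  have "same_order (prefix_flattening \<pi> j) (take j (prefix_flattening \<pi> k))"
    using assms by (intro same_order_trans[OF prefix_flattening_same_order[OF assms(1)] same_order_sym[OF *]]) auto
  moreover have "prefix_flattening \<pi> j \<in> perms j"
    using assms by (intro prefix_flattening_perms[OF assms(1)]) auto
  ultimately show ?thesis
    using prefix_flattening_iff[OF prefix_flattening_perms[OF assms(1,2)] assms(3)] by blast
qed

section \<open>Left-to-right maxima and the position of the largest entry\<close>

lemma prefix_flattening_last_eq_iff:
  assumes "\<pi> \<in> perms n" "i < n"
  shows "prefix_flattening \<pi> (Suc i) ! i = Suc i \<longleftrightarrow> (\<forall>j<i. \<pi> ! j < \<pi> ! i)"
proof -
  let ?\<sigma> = "prefix_flattening \<pi> (Suc i)"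
  have p: "?\<sigma> \<in> perms (Suc i)" using assms by (intro prefix_flattening_perms) auto
  have "same_order ?\<sigma> (take (Suc i) \<pi>)" using assms by (intro prefix_flattening_same_order) auto
  then have o: "?\<sigma> ! j < ?\<sigma> ! i \<longleftrightarrow> \<pi> ! j < \<pi> ! i" if "j < i" for j
    using same_order_nth_less_iff[of ?\<sigma> "take (Suc i) \<pi>" j i] that assms perms_length[of \<pi> n] by simp
  have "?\<sigma> ! i = Suc i \<longleftrightarrow> (\<forall>j<i. ?\<sigma> ! j < ?\<sigma> ! i)"
  proof
    assume e: "?\<sigma> ! i = Suc i"
    show "\<forall>j<i. ?\<sigma> ! j < ?\<sigma> ! i"
      using perms_nth_bounds[OF p] perms_nth_eq_iff[OF p] e by (metis less_Suc_eq less_irrefl nat_less_le)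
  next
    assume a: "\<forall>j<i. ?\<sigma> ! j < ?\<sigma> ! i"
    obtain j where "j < Suc i" "?\<sigma> ! j = Suc i" using perms_obtain_nth[OF p, of "Suc i"] by auto
    then show "?\<sigma> ! i = Suc i"
      using a perms_nth_bounds[OF p, of i] by (metis less_Suc_eq lessI not_less)
  qed
  with o show ?thesis by auto
qed

text \<open>The largest entry is the last left-to-right maximum, and left-to-right maxima are
  visible in the flattenings. Hence a strike can be read off the ancestors of
  \<open>\<pi>\<close>.\<close>

lemma perms_nth_eq_top_iff:
  assumes "\<pi> \<in> perms n" "i < n"
  shows "\<pi> ! i = n \<longleftrightarrow> prefix_flattening \<pi> (Suc i) ! i = Suc i \<and>
    (\<forall>j. i < j \<and> j < n \<longrightarrow> prefix_flattening \<pi> (Suc j) ! j \<noteq> Suc j)"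
proof
  assume e: "\<pi> ! i = n"
  have "\<pi> ! j < \<pi> ! i" if "j < n" "j \<noteq> i" for j
    using perms_nth_bounds[OF assms(1) that(1)] perms_nth_eq_iff[OF assms(1) that(1) assms(2)] e that
    by (simp add: nat_less_le)
  then show "prefix_flattening \<pi> (Suc i) ! i = Suc i \<and>
    (\<forall>j. i < j \<and> j < n \<longrightarrow> prefix_flattening \<pi> (Suc j) ! j \<noteq> Suc j)"
    using assms prefix_flattening_last_eq_iff[OF assms(1)] by (metis less_asym less_irrefl less_trans)
next
  assume a: "prefix_flattening \<pi> (Suc i) ! i = Suc i \<and>
    (\<forall>j. i < j \<and> j < n \<longrightarrow> prefix_flattening \<pi> (Suc j) ! j \<noteq> Suc j)"
  \<comment> \<open>\<open>m\<close> is the true position of the maximum. If \<open>i < m\<close>,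
    then \<open>m\<close> is a later left-to-right maximum; if \<open>m < i\<close>, then the entry
    at \<open>i\<close> would have to exceed \<open>n\<close>.\<close>
  obtain m where m: "m < n" "\<pi> ! m = n" using perms_obtain_nth[OF assms(1), of n] assms(2) by auto
  have "\<pi> ! j < \<pi> ! m" if "j < m" for j
    using perms_nth_bounds[OF assms(1), of j] perms_nth_eq_iff[OF assms(1), of j m] m that
    by (simp add: nat_less_le)
  then have "\<not> i < m" using a m prefix_flattening_last_eq_iff[OF assms(1)] by auto
  moreover have "\<not> m < i"
    using a m prefix_flattening_last_eq_iff[OF assms] perms_nth_bounds[OF assms] by (meson not_less)
  ultimately show "\<pi> ! i = n" using m by (metis linorder_neqE_nat)
qed

section \<open>Admissible label sequences\<close>

text \<open>A standard family counted by the Catalan numbers. Only \<open>k \<ge> 1\<close> is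
  meaningful, since \<open>[] ! 0\<close> is unspecified.\<close>

definition catalan_codes :: "nat \<Rightarrow> nat list set" where
  "catalan_codes k = {xs. length xs = k \<and> xs ! 0 = 0 \<and> (\<forall>i. Suc i < k \<longrightarrow> xs ! Suc i \<le> Suc (xs ! i))}"

lemma catalan_codes_1: "catalan_codes 1 = {[0]}"
  by (auto simp: catalan_codes_def length_Suc_conv One_nat_def)

lemma catalan_codes_snoc:
  assumes "k \<ge> 1" "length xs = k"
  shows "xs @ [y] \<in> catalan_codes (Suc k) \<longleftrightarrow> xs \<in> catalan_codes k \<and> y \<le> Suc (last xs)"
proof -
  obtain m where m: "k = Suc m" using assms by (cases k) auto
  have l: "last xs = xs ! m" using assms m by (subst last_conv_nth) auto
  show ?thesis
    using assms unfolding catalan_codes_def l m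
    by (auto simp: nth_append less_Suc_eq all_conj_distrib imp_conjL)
qed

text \<open>Zero is always an allowed next label, so no code is a dead end. This later yields
  descendants at level \<open>N\<close>.\<close>

lemma catalan_codes_replicate:
  "k \<ge> 1 \<Longrightarrow> xs \<in> catalan_codes k \<Longrightarrow> xs @ replicate m 0 \<in> catalan_codes (k + m)"
proof (induction m)
  case (Suc m)
  then have "(xs @ replicate m 0) @ [0] \<in> catalan_codes (Suc (k + m))"
    by (subst catalan_codes_snoc) (auto simp: catalan_codes_def)
  then show ?case by (simp add: replicate_append_same)
qed simp

lemma bij_betw_card_Collect:
  assumes "bij_betw f A B" "\<And>x. x \<in> A \<Longrightarrow> P x \<longleftrightarrow> Q (f x)"
  shows "card {x \<in> A. P x} = card {y \<in> B. Q y}"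
proof (rule bij_betw_same_card[of f])
  show "bij_betw f {x \<in> A. P x} {y \<in> B. Q y}"
    using assms by (auto simp: bij_betw_def intro: inj_on_subset)
qed

section \<open>Trees of permutations governed by the common generating rule\<close>

text \<open>The interface shared by the two classes: \<open>A k\<close> is a level of the tree,
  flattening by one entry gives the parent, \<open>children\<close> is the generating rule, and
  \<open>b_eq_0_iff\<close> ties labels to left-to-right maxima and hence to strikes.\<close>

locale label_tree =
  fixes A :: "nat \<Rightarrow> nat list set" and b :: "nat list \<Rightarrow> nat"
  assumes A_perms: "r \<in> A k \<Longrightarrow> r \<in> perms k"
    and A_1: "A 1 = {[1]}"
    and b_1: "b [1] = 0"
    and A_prefix: "k \<ge> 1 \<Longrightarrow> r \<in> A (Suc k) \<Longrightarrow> prefix_flattening r k \<in> A k"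
    and children: "k \<ge> 1 \<Longrightarrow> q \<in> A k \<Longrightarrow>
      bij_betw b {r \<in> A (Suc k). prefix_flattening r k = q} {..Suc (b q)}"
    and b_eq_0_iff: "r \<in> A (Suc k) \<Longrightarrow> b r = 0 \<longleftrightarrow> r ! k = Suc k"
begin

definition code :: "nat list \<Rightarrow> nat list" where
  "code r = map (\<lambda>i. b (prefix_flattening r (Suc i))) [0..<length r]"

lemma length_code [simp]: "length (code r) = length r"
  by (simp add: code_def)

lemma code_nth: "i < length r \<Longrightarrow> code r ! i = b (prefix_flattening r (Suc i))"
  by (simp add: code_def)

lemma A_length: "r \<in> A k \<Longrightarrow> length r = k"
  using A_perms perms_length by blast

text \<open>Iterated flattening collapses to a single one, so passing to an ancestor truncates the
  label path. The tree order thereby becomes the prefix order on lists.\<close>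

lemma code_prefix_flattening:
  assumes "r \<in> perms n" "k \<le> n"
  shows "code (prefix_flattening r k) = take k (code r)"
proof -
  have l: "length (prefix_flattening r k) = k" "length r = n"
    using assms perms_length prefix_flattening_perms by blast+
  show ?thesis
    by (rule nth_equalityI)
      (use l assms in \<open>auto simp: code_nth prefix_flattening_prefix_flattening[OF assms]\<close>)
qed

lemma A_prefix_flattening:
  assumes "k \<ge> 1" "k \<le> n" "r \<in> A n"
  shows "prefix_flattening r k \<in> A k"
  using assms(2,3)
proof (induction n arbitrary: r rule: dec_induct)
  case base
  then show ?case using A_perms prefix_flattening_self by metis
next
  case (step n)
  then have "prefix_flattening (prefix_flattening r n) k \<in> A k"
    using A_prefix[of n r] assms(1) by simp
  then show ?case
    using prefix_flattening_prefix_flattening[OF A_perms[OF step.prems], of n k] step.hyps by simp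
qed

lemma code_Suc:
  assumes "r \<in> A (Suc k)"
  shows "code r = code (prefix_flattening r k) @ [b r]"
proof -
  have p: "r \<in> perms (Suc k)" "length r = Suc k" using assms A_perms A_length by auto
  then show ?thesis
    unfolding code_prefix_flattening[OF p(1) le_SucI[OF le_refl]]
    using take_Suc_conv_app_nth[of k "code r"] code_nth[of k r] prefix_flattening_self[OF p(1)] by simp
qed

lemma last_code:
  assumes "k \<ge> 1" "r \<in> A k"
  shows "last (code r) = b r"
  using assms code_Suc[of r "k - 1"] by simp

text \<open>Induction on the level: the shorter code determines the parent, and
  \<open>children\<close> says which labels occur below it, each exactly once.\<close>

lemma bij_betw_code: "k \<ge> 1 \<Longrightarrow> bij_betw code (A k) (catalan_codes k)"
proof (induction k rule: nat_induct_at_least)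
  case base
  have "code [1] = [0]"
    using prefix_flattening_self[of "[1]" 1] b_1 by (simp add: code_def perms_iff One_nat_def)
  then show ?case unfolding A_1 catalan_codes_1 by (simp add: bij_betw_def)
next
  case (Suc k)
  have inj: "inj_on code (A k)" and im: "code ` A k = catalan_codes k"
    using Suc.IH by (auto simp: bij_betw_def)
  show ?case unfolding bij_betw_def
  proof (intro conjI equalityI subsetI inj_onI)
    fix r s assume rs: "r \<in> A (Suc k)" "s \<in> A (Suc k)" "code r = code s"
    then have "code (prefix_flattening r k) = code (prefix_flattening s k)" and b: "b r = b s"
      using code_Suc[of r k] code_Suc[of s k] by auto
    then have e: "prefix_flattening s k = prefix_flattening r k"
      using inj A_prefix[OF Suc.hyps] rs by (metis inj_onD)
    have "inj_on b {t \<in> A (Suc k). prefix_flattening t k = prefix_flattening r k}"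
      using children[OF Suc.hyps A_prefix[OF Suc.hyps rs(1)]] by (simp add: bij_betw_def)
    then show "r = s" using rs b e by (auto dest: inj_onD)
  next
    fix xs assume "xs \<in> code ` A (Suc k)"
    then obtain r where r: "r \<in> A (Suc k)" "xs = code r" by auto
    let ?q = "prefix_flattening r k"
    have q: "?q \<in> A k" by (rule A_prefix[OF Suc.hyps r(1)])
    have "b r \<le> Suc (b ?q)"
      using bij_betwE[OF children[OF Suc.hyps q]] r by auto
    then show "xs \<in> catalan_codes (Suc k)"
      unfolding r(2) code_Suc[OF r(1)]
      using q im A_length[OF q] last_code[OF Suc.hyps q] Suc.hyps
      by (subst catalan_codes_snoc) auto
  next
    fix xs assume xs: "xs \<in> catalan_codes (Suc k)"
    then have l: "length xs = Suc k" by (simp add: catalan_codes_def)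
    then obtain ys y where y: "xs = ys @ [y]" by (metis Zero_not_Suc length_0_conv rev_exhaust)
    then have "ys \<in> catalan_codes k" and le: "y \<le> Suc (last ys)"
      using catalan_codes_snoc[OF Suc.hyps, of ys y] xs l by auto
    then obtain q where q: "q \<in> A k" "ys = code q" using im by blast
    then have "y \<in> b ` {r \<in> A (Suc k). prefix_flattening r k = q}"
      using children[OF Suc.hyps q(1)] le last_code[OF Suc.hyps q(1)] by (simp add: bij_betw_def)
    then obtain r where "r \<in> A (Suc k)" "prefix_flattening r k = q" "y = b r" by blast
    then show "xs \<in> code ` A (Suc k)" using code_Suc[of r k] q y by (intro image_eqI[of _ _ r]) auto
  qed
qed

lemma code_eq_iff:
  assumes "r \<in> A m" "s \<in> A n" "m \<ge> 1" "n \<ge> 1"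
  shows "code r = code s \<longleftrightarrow> r = s"
  using assms A_length length_code bij_betw_code[of m] by (metis bij_betw_inv_into_left)

text \<open>One inclusion is closure under flattening. The other needs a descendant at level
  \<open>N\<close> for every node.\<close>

lemma perm_prefixes_eq: "perm_prefixes N (A N) = (\<Union>k\<in>{1..N}. A k)"
proof (intro equalityI subsetI)
  fix p assume "p \<in> perm_prefixes N (A N)"
  then show "p \<in> (\<Union>k\<in>{1..N}. A k)"
    using A_prefix_flattening by (fastforce simp: perm_prefixes_def)
next
  fix p assume "p \<in> (\<Union>k\<in>{1..N}. A k)"
  then obtain k where k: "1 \<le> k" "k \<le> N" "p \<in> A k" by auto
  then have "code p \<in> catalan_codes k" using bij_betw_code bij_betwE by blast
  \<comment> \<open>Padding with zeros gives an admissible code of length \<open>N\<close>; the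
    permutation it encodes is the required descendant of \<open>p\<close>.\<close>
  from catalan_codes_replicate[OF k(1) this, of "N - k"] k
  have "code p @ replicate (N - k) 0 \<in> code ` A N"
    using bij_betw_code[of N] by (simp add: bij_betw_def)
  then obtain \<pi> where pi: "\<pi> \<in> A N" "code \<pi> = code p @ replicate (N - k) 0" by auto
  then have "code (prefix_flattening \<pi> k) = code p"
    using code_prefix_flattening[OF A_perms[OF pi(1)] k(2)] A_length[OF k(3)] by simp
  then have "prefix_flattening \<pi> k = p"
    using code_eq_iff[OF A_prefix_flattening[OF k(1,2) pi(1)] k(3)] k by simp
  then show "p \<in> perm_prefixes N (A N)"
    using k pi A_perms unfolding perm_prefixes_def by blast
qed

lemma bij_betw_code_perm_prefixes:
  "bij_betw code (perm_prefixes N (A N)) (\<Union>k\<in>{1..N}. catalan_codes k)"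
  unfolding perm_prefixes_eq bij_betw_def
proof
  show "inj_on code (\<Union>k\<in>{1..N}. A k)" by (rule inj_onI) (use code_eq_iff in auto)
  show "code ` (\<Union>k\<in>{1..N}. A k) = (\<Union>k\<in>{1..N}. catalan_codes k)"
    using bij_betw_code by (auto simp: bij_betw_def image_UN)
qed

lemma is_prefix_flattening_iff:
  assumes "p \<in> perm_prefixes N (A N)" "q \<in> perm_prefixes N (A N)"
  shows "is_prefix_flattening p q \<longleftrightarrow> prefix (code p) (code q)"
proof -
  obtain k m where k: "k \<ge> 1" "p \<in> A k" and m: "m \<ge> 1" "q \<in> A m"
    using assms unfolding perm_prefixes_eq by auto
  have l: "length p = k" "length q = m" using k m A_length by auto
  have "prefix_flattening q k = p \<longleftrightarrow> take k (code q) = code p" if "k \<le> m"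
    using code_prefix_flattening[OF A_perms[OF m(2)] that] k m
      code_eq_iff[OF A_prefix_flattening[OF k(1) that m(2)] k(2)] by metis
  moreover have "prefix (code p) (code q) \<longleftrightarrow> k \<le> m \<and> take k (code q) = code p"
    using l prefix_length_le[of "code p" "code q"] take_is_prefix[of k "code q"]
    by (metis append_eq_conv_conj length_code prefix_def)
  ultimately show ?thesis unfolding is_prefix_flattening_def l by auto
qed

text \<open>The right-hand side depends on \<open>p\<close> only through its length and code, and
  not on the tree, so it can be compared between two label trees.\<close>

lemma strike_eq:
  assumes "p \<in> perm_prefixes N (A N)"
  shows "strike N (A N) p =
    (card {xs \<in> catalan_codes N. take (length p) xs = code p \<and> xs ! (length p - 1) = 0 \<and>
        (\<forall>j. length p \<le> j \<and> j < N \<longrightarrow> xs ! j \<noteq> 0)},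
     card {xs \<in> catalan_codes N. take (length p) xs = code p})"
proof -
  obtain k where k: "1 \<le> k" "k \<le> N" "p \<in> A k" using assms unfolding perm_prefixes_eq by auto
  have l: "length p = k" using k A_length by auto
  have pre: "prefix_flattening \<pi> k = p \<longleftrightarrow> take k (code \<pi>) = code p" if "\<pi> \<in> A N" for \<pi>
    using code_prefix_flattening[OF A_perms[OF that] k(2)] k
      code_eq_iff[OF A_prefix_flattening[OF k(1,2) that] k(3)] by metis
  have label: "prefix_flattening \<pi> (Suc j) ! j = Suc j \<longleftrightarrow> code \<pi> ! j = 0" if "\<pi> \<in> A N" "j < N" for \<pi> j
    using b_eq_0_iff[OF A_prefix_flattening[of "Suc j" N \<pi>]] that A_length[of \<pi> N] code_nth[of j \<pi>] by simp
  \<comment> \<open>The last left-to-right maximum is the last zero of the code; list index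
    \<open>k - 1\<close> is the \<open>k\<close>th place.\<close>
  have top: "\<pi> ! (k - 1) = N \<longleftrightarrow>
      code \<pi> ! (k - 1) = 0 \<and> (\<forall>j. k \<le> j \<and> j < N \<longrightarrow> code \<pi> ! j \<noteq> 0)" if "\<pi> \<in> A N" for \<pi>
  proof -
    have "\<pi> ! (k - 1) = N \<longleftrightarrow> prefix_flattening \<pi> (Suc (k - 1)) ! (k - 1) = Suc (k - 1) \<and>
      (\<forall>j. k - 1 < j \<and> j < N \<longrightarrow> prefix_flattening \<pi> (Suc j) ! j \<noteq> Suc j)"
      using k by (intro perms_nth_eq_top_iff A_perms that) auto
    also have "\<dots> \<longleftrightarrow> code \<pi> ! (k - 1) = 0 \<and> (\<forall>j. k - 1 < j \<and> j < N \<longrightarrow> code \<pi> ! j \<noteq> 0)"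
      using label[OF that] k by (metis One_nat_def Suc_le_lessD Suc_pred le_less_trans)
    also have "(\<forall>j. k - 1 < j \<and> j < N \<longrightarrow> code \<pi> ! j \<noteq> 0) \<longleftrightarrow> (\<forall>j. k \<le> j \<and> j < N \<longrightarrow> code \<pi> ! j \<noteq> 0)"
      using k by (metis One_nat_def Suc_le_eq Suc_pred)
    finally show ?thesis .
  qed
  have bij: "bij_betw code (A N) (catalan_codes N)" using k by (intro bij_betw_code) auto
  show ?thesis unfolding strike_def l prod.inject
    by (intro conjI bij_betw_card_Collect[OF bij]) (use pre top in auto)
qed

end

text \<open>Both trees are encoded by the same label sequences, so one code followed by the inverse
  of the other matches nodes; tree order and strikes are already expressed through codes.\<close>

lemma label_tree_isomorphism:
  assumes "label_tree A a" "label_tree B b"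
  shows "\<exists>\<Phi>. bij_betw \<Phi> (perm_prefixes N (A N)) (perm_prefixes N (B N))
    \<and> (\<forall>p \<in> perm_prefixes N (A N). \<forall>q \<in> perm_prefixes N (A N).
          is_prefix_flattening p q \<longleftrightarrow> is_prefix_flattening (\<Phi> p) (\<Phi> q))
    \<and> (\<forall>p \<in> perm_prefixes N (A N). strike N (B N) (\<Phi> p) = strike N (A N) p)"
proof -
  interpret A: label_tree A a by fact
  interpret B: label_tree B b by fact
  let ?P = "perm_prefixes N (A N)" and ?Q = "perm_prefixes N (B N)"
  define \<Phi> where "\<Phi> = inv_into ?Q B.code \<circ> A.code"
  note bijA = A.bij_betw_code_perm_prefixes[of N] and bijB = B.bij_betw_code_perm_prefixes[of N]
  have bij: "bij_betw \<Phi> ?P ?Q"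
    unfolding \<Phi>_def by (rule bij_betw_trans[OF bijA bij_betw_inv_into[OF bijB]])
  have code: "B.code (\<Phi> p) = A.code p" if "p \<in> ?P" for p
    using bij_betw_inv_into_right[OF bijB] bij_betwE[OF bijA] that by (simp add: \<Phi>_def)
  have mem: "\<Phi> p \<in> ?Q" if "p \<in> ?P" for p using bij_betwE[OF bij] that by blast
  \<comment> \<open>The strike formula refers to the length of the node besides its code.\<close>
  have len: "length (\<Phi> p) = length p" if "p \<in> ?P" for p
    using code[OF that] A.length_code B.length_code by metis
  show ?thesis
    using bij code len
    by (intro exI[of _ \<Phi>])
      (simp add: A.is_prefix_flattening_iff B.is_prefix_flattening_iff[OF mem mem] A.strike_eq B.strike_eq[OF mem])
qed

section \<open>Patterns of length three as conditions on index triples\<close>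

lemma subseq_Cons_iff_nth:
  "subseq (a # s) ys \<longleftrightarrow> (\<exists>i<length ys. ys ! i = a \<and> subseq s (drop (Suc i) ys))"
proof
  assume "subseq (a # s) ys"
  then obtain us vs where "ys = us @ a # vs" "subseq s vs" by (auto dest: list_emb_ConsD)
  then show "\<exists>i<length ys. ys ! i = a \<and> subseq s (drop (Suc i) ys)"
    by (intro exI[of _ "length us"]) auto
next
  assume "\<exists>i<length ys. ys ! i = a \<and> subseq s (drop (Suc i) ys)"
  then obtain i where "i < length ys" "ys ! i = a" "subseq s (drop (Suc i) ys)" by auto
  then have "subseq (a # s) (take i ys @ ys ! i # drop (Suc i) ys)"
    by (intro list_emb_append2) simp
  then show "subseq (a # s) ys"
    using id_take_nth_drop[OF \<open>i < length ys\<close>] by simp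
qed

lemma subseq_3_iff_nth:
  "subseq [x, y, z] ys \<longleftrightarrow>
    (\<exists>i j l. i < j \<and> j < l \<and> l < length ys \<and> ys ! i = x \<and> ys ! j = y \<and> ys ! l = z)"
  (is "?L \<longleftrightarrow> ?R")
proof
  assume ?L
  then obtain i where i: "i < length ys" "ys ! i = x" "subseq [y, z] (drop (Suc i) ys)"
    using subseq_Cons_iff_nth[of x] by blast
  then obtain j where j: "j < length ys - Suc i" "ys ! (Suc i + j) = y"
    "subseq [z] (drop (Suc j) (drop (Suc i) ys))"
    using subseq_Cons_iff_nth[of y] by auto
  then obtain l where "l < length ys - Suc i - Suc j" "ys ! (Suc i + (Suc j + l)) = z"
    using subseq_Cons_iff_nth[of z "[]" "drop (Suc j) (drop (Suc i) ys)"] by (force simp: ac_simps)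
  with i j show ?R by (intro exI[of _ i] exI[of _ "Suc i + j"] exI[of _ "Suc i + (Suc j + l)"]) auto
next
  assume ?R
  then obtain i j l where *: "i < j" "j < l" "l < length ys" "ys ! i = x" "ys ! j = y" "ys ! l = z"
    by auto
  have "subseq [z] (drop (Suc j) ys)"
    unfolding subseq_Cons_iff_nth using * by (intro exI[of _ "l - Suc j"]) auto
  then have "subseq [y, z] (drop (Suc i) ys)"
    unfolding subseq_Cons_iff_nth[of y] using * by (intro exI[of _ "j - Suc i"]) auto
  then show ?L
    unfolding subseq_Cons_iff_nth[of x] using * by (intro exI[of _ i]) auto
qed

text \<open>\<open>P\<close> spells out the order condition of \<open>\<rho>\<close> on three
  values; since \<open>same_order\<close> compares lengths, every occurrence consists of three
  entries.\<close>

lemma Av_length_3_iff: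
  assumes "\<And>x y z. same_order [x, y, z] \<rho> \<longleftrightarrow> P x y z" "length \<rho> = 3"
  shows "\<pi> \<in> Av k \<rho> \<longleftrightarrow> \<pi> \<in> perms k \<and>
    (\<forall>i j l. i < j \<and> j < l \<and> l < k \<longrightarrow> \<not> P (\<pi> ! i) (\<pi> ! j) (\<pi> ! l))"
proof -
  have "(\<exists>s. subseq s \<pi> \<and> same_order s \<rho>) \<longleftrightarrow> (\<exists>x y z. subseq [x, y, z] \<pi> \<and> P x y z)"
  proof (intro iffI; elim exE conjE)
    fix s assume s: "subseq s \<pi>" "same_order s \<rho>"
    then have "length s = Suc (Suc (Suc 0))" using assms(2) by (simp add: same_order_def)
    then obtain x y z where "s = [x, y, z]" by (metis length_0_conv length_Suc_conv)
    then show "\<exists>x y z. subseq [x, y, z] \<pi> \<and> P x y z" using s assms(1) by blast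
  qed (use assms(1) in blast)
  then show ?thesis
    unfolding Av_def subseq_3_iff_nth using perms_length[of \<pi> k] by blast
qed

lemma Av_231_iff:
  "\<pi> \<in> Av k [2, 3, 1] \<longleftrightarrow> \<pi> \<in> perms k \<and>
    (\<forall>i j l. i < j \<and> j < l \<and> l < k \<longrightarrow> \<not> (\<pi> ! l < \<pi> ! i \<and> \<pi> ! i < \<pi> ! j))"
  by (rule Av_length_3_iff) (auto simp: same_order_def All_less_Suc2)

lemma Av_132_iff:
  "\<pi> \<in> Av k [1, 3, 2] \<longleftrightarrow> \<pi> \<in> perms k \<and>
    (\<forall>i j l. i < j \<and> j < l \<and> l < k \<longrightarrow> \<not> (\<pi> ! i < \<pi> ! l \<and> \<pi> ! l < \<pi> ! j))"
  by (rule Av_length_3_iff) (auto simp: same_order_def All_less_Suc2)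

section \<open>Closure of avoidance classes under prefix flattening\<close>

lemma same_order_nths:
  assumes "same_order xs ys"
  shows "same_order (nths xs I) (nths ys I)"
proof -
  define J where "J = nths [0..<length xs] I"
  have l: "length ys = length xs" using assms by (simp add: same_order_def)
  have "nths xs I = map ((!) xs) J" "nths ys I = map ((!) ys) J"
    using nths_map[of "(!) xs" "[0..<length xs]" I] nths_map[of "(!) ys" "[0..<length ys]" I]
    unfolding J_def by (metis map_nth, metis map_nth l)
  moreover have "J ! i < length xs" if "i < length J" for i
    using nth_mem[OF that] in_set_nthsD unfolding J_def by fastforce
  ultimately show ?thesis using assms by (simp add: same_order_def)
qed

text \<open>An occurrence of the pattern in the flattening sits at positions that carry an
  occurrence in \<open>\<pi>\<close> too.\<close>

lemma Av_prefix_flattening: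
  assumes "\<pi> \<in> Av n \<rho>" "k \<le> n"
  shows "prefix_flattening \<pi> k \<in> Av k \<rho>"
proof -
  let ?\<sigma> = "prefix_flattening \<pi> k"
  have p: "\<pi> \<in> perms n" using assms(1) by (simp add: Av_def)
  have so: "same_order ?\<sigma> (take k \<pi>)" by (rule prefix_flattening_same_order[OF p assms(2)])
  have "\<not> same_order s \<rho>" if "subseq s ?\<sigma>" for s
  proof
    assume s: "same_order s \<rho>"
    obtain I where I: "s = nths ?\<sigma> I" using \<open>subseq s ?\<sigma>\<close> by (auto simp: subseq_conv_nths)
    have "same_order (nths ?\<sigma> I) (nths (take k \<pi>) I)"
      by (rule same_order_nths[OF so])
    then have "same_order (nths (take k \<pi>) I) \<rho>"
      using s I same_order_sym same_order_trans by blast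
    moreover have "subseq (nths (take k \<pi>) I) \<pi>"
      using subseq_conv_nths[of "nths (take k \<pi>) I" "take k \<pi>"] prefix_imp_subseq[OF take_is_prefix]
        subseq_order.trans by blast
    ultimately show False using assms(1) by (auto simp: Av_def)
  qed
  then show ?thesis using prefix_flattening_perms[OF p assms(2)] by (auto simp: Av_def)
qed

lemma Av_perms: "\<pi> \<in> Av k \<rho> \<Longrightarrow> \<pi> \<in> perms k"
  by (simp add: Av_def)

lemma Av_1:
  assumes "length \<rho> > 1"
  shows "Av 1 \<rho> = {[1]}"
proof -
  have "perms 1 = {[1]}" by simp
  then show ?thesis
    using assms list_emb_length[of "(=)" _ "[1::nat]"] by (fastforce simp: Av_def same_order_def)
qed

section \<open>Extending a permutation by a last entry of given rank\<close>

text \<open>The new last entry is exceeded by exactly \<open>e\<close> of the others, if \<open>e \<le> length q\<close>.\<close>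

definition append_rank :: "nat list \<Rightarrow> nat \<Rightarrow> nat list" where
  "append_rank q e = map (\<lambda>x. if length q - e < x then Suc x else x) q @ [Suc (length q) - e]"

context
  fixes q :: "nat list" and k :: nat
  assumes q: "q \<in> perms k"
begin

lemma append_rank_nth_last: "append_rank q e ! k = Suc k - e"
  using perms_length[OF q] by (simp add: append_rank_def nth_append)

lemma append_rank_nth_less_iff:
  "i < k \<Longrightarrow> j < k \<Longrightarrow> append_rank q e ! i < append_rank q e ! j \<longleftrightarrow> q ! i < q ! j"
  using perms_length[OF q] by (auto simp: append_rank_def nth_append)

lemma append_rank_nth_less_last_iff:
  "i < k \<Longrightarrow> e \<le> k \<Longrightarrow> append_rank q e ! i < append_rank q e ! k \<longleftrightarrow> q ! i \<le> k - e"
  using perms_length[OF q] by (auto simp: append_rank_def nth_append Suc_diff_le)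

lemma append_rank_last_less_nth_iff:
  "i < k \<Longrightarrow> e \<le> k \<Longrightarrow> append_rank q e ! k < append_rank q e ! i \<longleftrightarrow> k - e < q ! i"
  using perms_length[OF q] by (auto simp: append_rank_def nth_append Suc_diff_le)

lemma append_rank_perms:
  assumes "e \<le> k"
  shows "append_rank q e \<in> perms (Suc k)"
proof -
  have l: "length q = k" and d: "distinct q" and s: "set q = {1..k}"
    using perms_length[OF q] q by (auto simp: perms_iff)
  let ?f = "\<lambda>x. if k - e < x then Suc x else x"
  have "inj_on ?f (set q)" by (auto simp: inj_on_def split: if_splits)
  moreover have "Suc k - e \<notin> ?f ` set q" using assms by (auto split: if_splits)
  ultimately have d': "distinct (append_rank q e)"
    using d by (auto simp: append_rank_def l distinct_map)
  have "set (append_rank q e) \<subseteq> {1..Suc k}"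
    using assms s by (auto simp: append_rank_def l)
  with d' show ?thesis by (rule permsI) (simp add: append_rank_def l)
qed

lemma prefix_flattening_append_rank:
  assumes "e \<le> k"
  shows "prefix_flattening (append_rank q e) k = q"
proof -
  have "same_order q (take k (append_rank q e))"
    using perms_length[OF q] perms_length[OF append_rank_perms[OF assms]]
    by (auto simp: same_order_def append_rank_nth_less_iff)
  then show ?thesis
    using prefix_flattening_iff[OF append_rank_perms[OF assms]] q by simp
qed

text \<open>The rank is read off the last entry; deleting that entry and closing the gap in the
  values recovers \<open>q\<close>.\<close>

lemma perms_children:
  assumes "r \<in> perms (Suc k)" "prefix_flattening r k = q"
  obtains e where "e \<le> k" "r = append_rank q e"
proof
  let ?v = "r ! k"
  let ?e = "Suc k - ?v"
  \<comment> \<open>Closes the gap at \<open>?v\<close>; it is strictly monotone on the other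
    entries because none of them equals \<open>?v\<close>.\<close>
  let ?g = "\<lambda>x. if ?v < x then x - 1 else x"
  let ?q = "map ?g (take k r)"
  have lr: "length r = Suc k" by (rule perms_length[OF assms(1)])
  have v: "1 \<le> ?v" "?v \<le> Suc k" using perms_nth_bounds[OF assms(1), of k] by auto
  have r: "r = take k r @ [?v]" using lr take_Suc_conv_app_nth[of k r] by simp
  have dr: "distinct r" and sr: "set r = {1..Suc k}" using assms(1) by (auto simp: perms_iff)
  have ne: "?v \<notin> set (take k r)" and dt: "distinct (take k r)"
    using dr by (subst (asm) r, simp)+
  have lt: "?g x < ?g y \<longleftrightarrow> x < y" if "x \<in> set (take k r)" "y \<in> set (take k r)" for x y
  proof -
    have "x \<noteq> ?v" "y \<noteq> ?v" using that ne by auto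
    then show ?thesis by auto
  qed
  have so: "same_order ?q (take k r)"
    unfolding same_order_def
  proof (intro conjI allI impI)
    fix i j assume "i < length ?q" "j < length ?q"
    then show "?q ! i < ?q ! j \<longleftrightarrow> take k r ! i < take k r ! j"
      using lt[OF nth_mem nth_mem, of i j] by (simp only: length_map nth_map)
  qed simp
  have "inj_on ?g (set (take k r))"
  proof (rule linorder_inj_onI')
    fix x y assume "x \<in> set (take k r)" "y \<in> set (take k r)" "x < y"
    then have "?g x < ?g y" using lt by blast
    then show "?g x \<noteq> ?g y" by (rule less_imp_neq)
  qed
  then have d: "distinct ?q" using dt by (simp add: distinct_map)
  have "?g x \<in> {1..k}" if "x \<in> set (take k r)" for x
  proof -
    have "x \<noteq> ?v" using that ne by blast
    moreover have "x \<in> {1..Suc k}" using sr in_set_takeD[OF that] by blast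
    ultimately show ?thesis using v by (cases "?v < x") auto
  qed
  then have "set ?q \<subseteq> {1..k}" unfolding set_map by blast
  with d have "?q \<in> perms k" by (rule permsI) (simp add: lr)
  with so have qq: "?q = q" using prefix_flattening_iff[OF assms(1), of k ?q] assms(2) by simp
  show "?e \<le> k" using v by simp
  \<comment> \<open>Reopens the gap: \<open>k - ?e\<close> is \<open>?v - 1\<close>, so the shift
    applies precisely to values at least \<open>?v\<close>.\<close>
  let ?h = "\<lambda>x. if k - ?e < x then Suc x else x"
  have "map ?h ?q = map (?h \<circ> ?g) (take k r)" by (rule map_map)
  also have "\<dots> = take k r"
  proof (rule map_idI)
    fix x assume "x \<in> set (take k r)"
    then have "x \<noteq> ?v" using ne by blast
    then show "(?h \<circ> ?g) x = x" using v by (cases "?v < x") auto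
  qed
  finally have "map ?h q = take k r" unfolding qq .
  then have "append_rank q ?e = take k r @ [?v]"
    using perms_length[OF q] v by (simp add: append_rank_def)
  with r show "r = append_rank q ?e" by simp
qed

lemma append_rank_inj: "inj_on (append_rank q) {..k}"
proof (rule inj_onI)
  fix d e assume "d \<in> {..k}" "e \<in> {..k}" "append_rank q d = append_rank q e"
  then show "d = e" using append_rank_nth_last[of d] append_rank_nth_last[of e] by simp
qed

text \<open>Reduces the generating rule for a pattern class to finding the set \<open>E\<close> of
  admissible ranks and computing the label as a function of the rank.\<close>

lemma bij_betw_children:
  assumes "\<And>e. e \<le> k \<Longrightarrow> append_rank q e \<in> Av (Suc k) \<rho> \<longleftrightarrow> e \<in> E" "E \<subseteq> {..k}"
    and b: "bij_betw (\<lambda>e. b (append_rank q e)) E M"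
  shows "bij_betw b {r \<in> Av (Suc k) \<rho>. prefix_flattening r k = q} M"
proof -
  have "{r \<in> Av (Suc k) \<rho>. prefix_flattening r k = q} = append_rank q ` E"
  proof (intro equalityI subsetI)
    fix r assume r: "r \<in> {r \<in> Av (Suc k) \<rho>. prefix_flattening r k = q}"
    then have "r \<in> perms (Suc k)" by (simp add: Av_def)
    then obtain e where "e \<le> k" "r = append_rank q e" using perms_children r by blast
    then show "r \<in> append_rank q ` E" using assms(1) r by auto
  next
    fix r assume "r \<in> append_rank q ` E"
    then show "r \<in> {r \<in> Av (Suc k) \<rho>. prefix_flattening r k = q}"
      using assms(1,2) prefix_flattening_append_rank by auto
  qed
  moreover have "bij_betw (append_rank q) E (append_rank q ` E)"
    using append_rank_inj assms(2) by (meson inj_on_imp_bij_betw inj_on_subset)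
  ultimately show ?thesis
    using b bij_betw_comp_iff[of "append_rank q" E _ b M] by (simp add: o_def)
qed

end

section \<open>The generating rule for 231\<close>

text \<open>In a permutation of \<open>{1..k}\<close> exactly \<open>k - v\<close> values exceed
  \<open>v\<close>, so the difference is the intended count.\<close>

definition label_231 :: "nat list \<Rightarrow> nat" where
  "label_231 r = length r - last r"

text \<open>A new 231 ends in the appended entry, so it needs an increasing pair of entries of
  \<open>q\<close> above the cutoff \<open>Suc m - e\<close>. Such a pair exists exactly when the
  cutoff is at least two below the last entry of \<open>q\<close>.\<close>

lemma append_rank_Av_231_iff:
  assumes "q \<in> Av (Suc m) [2, 3, 1]" "e \<le> Suc m"
  shows "append_rank q e \<in> Av (Suc (Suc m)) [2, 3, 1] \<longleftrightarrow> e \<le> Suc (label_231 q)"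
proof -
  have q: "q \<in> perms (Suc m)"
    and av: "\<And>i j l. i < j \<Longrightarrow> j < l \<Longrightarrow> l < Suc m \<Longrightarrow> \<not> (q ! l < q ! i \<and> q ! i < q ! j)"
    using assms(1) unfolding Av_231_iff by auto
  have "append_rank q e \<in> Av (Suc (Suc m)) [2, 3, 1] \<longleftrightarrow>
      (\<forall>i j. i < j \<and> j < Suc m \<longrightarrow> \<not> (Suc m - e < q ! i \<and> q ! i < q ! j))"
  proof -
    have "append_rank q e \<in> Av (Suc (Suc m)) [2, 3, 1] \<longleftrightarrow>
      (\<forall>i j l. i < j \<and> j < l \<and> l < Suc (Suc m) \<longrightarrow>
        \<not> (append_rank q e ! l < append_rank q e ! i \<and> append_rank q e ! i < append_rank q e ! j))"
      unfolding Av_231_iff using append_rank_perms[OF q assms(2)] by simp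
    also have "\<dots> \<longleftrightarrow> (\<forall>i j. i < j \<and> j < Suc m \<longrightarrow>
        \<not> (append_rank q e ! Suc m < append_rank q e ! i \<and> append_rank q e ! i < append_rank q e ! j))"
      (is "_ \<longleftrightarrow> ?R")
    proof (intro iffI allI impI)
      fix i j l assume r: ?R and *: "i < j \<and> j < l \<and> l < Suc (Suc m)"
      show "\<not> (append_rank q e ! l < append_rank q e ! i \<and> append_rank q e ! i < append_rank q e ! j)"
        using r * av[of i j l] append_rank_nth_less_iff[OF q] by (cases "l = Suc m") auto
    qed auto
    also have "\<dots> \<longleftrightarrow> (\<forall>i j. i < j \<and> j < Suc m \<longrightarrow> \<not> (Suc m - e < q ! i \<and> q ! i < q ! j))"
      using append_rank_last_less_nth_iff[OF q _ assms(2)] append_rank_nth_less_iff[OF q]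
      by (intro all_cong1 imp_cong refl) auto
    finally show ?thesis .
  qed
  also have "\<dots> \<longleftrightarrow> e \<le> Suc (label_231 q)"
  proof -
    have lab: "label_231 q = Suc m - q ! m"
      using perms_length[OF q] last_conv_nth[of q] by (cases q) (simp_all add: label_231_def)
    have bnd: "1 \<le> q ! m" "q ! m \<le> Suc m" using perms_nth_bounds[OF q, of m] by auto
    show ?thesis
    proof (intro iffI allI impI notI)
      assume a: "\<forall>i j. i < j \<and> j < Suc m \<longrightarrow> \<not> (Suc m - e < q ! i \<and> q ! i < q ! j)"
      show "e \<le> Suc (label_231 q)"
      proof (rule ccontr)
        assume "\<not> e \<le> Suc (label_231 q)"
        \<comment> \<open>The value just below the last entry of \<open>q\<close> is still above the
          cutoff and occurs earlier; with the last entry it forms the forbidden pair.\<close>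
        then have c: "Suc m - e < q ! m - 1" "1 \<le> q ! m - 1" using lab bnd assms(2) by auto
        then obtain i where i: "i < Suc m" "q ! i = q ! m - 1"
          using perms_obtain_nth[OF q c(2) le_trans[OF diff_le_self bnd(2)]] by blast
        moreover have "i \<noteq> m" using c i by auto
        ultimately have "i < m" "q ! i < q ! m" using c by auto
        moreover have "Suc m - e < q ! i" using c i by simp
        ultimately show False using a lessI by blast
      qed
    next
      fix i j assume e: "e \<le> Suc (label_231 q)" and ij: "i < j \<and> j < Suc m"
        and c: "Suc m - e < q ! i \<and> q ! i < q ! j"
      \<comment> \<open>The cutoff is at least \<open>q ! m - 1\<close>, so the pair followed by the
        last entry of \<open>q\<close> would be a 231 inside \<open>q\<close>.\<close>
      have ge: "q ! m \<le> q ! i" using e c lab bnd assms(2) by linarith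
      then have "j \<noteq> m" using c by auto
      then have "j < m" "i < m" using ij by auto
      then have "q ! m < q ! i" using ge perms_nth_eq_iff[OF q, of m i] by (simp add: nat_less_le)
      then show False using av[of i j m] \<open>j < m\<close> ij c by simp
    qed
  qed
  finally show ?thesis .
qed

text \<open>The admissible ranks form an initial segment and the label of a child equals its rank,
  so the required bijection is the identity on ranks.\<close>

lemma label_tree_231: "label_tree (\<lambda>k. Av k [2, 3, 1]) label_231"
proof
  fix k q assume k: "k \<ge> 1" and q: "q \<in> Av k [2, 3, 1]"
  then have p: "q \<in> perms k" by (simp add: Av_def)
  obtain m where m: "k = Suc m" using k by (cases k) auto
  have l: "length q = k" by (rule perms_length[OF p])
  have "1 \<le> q ! m" using perms_nth_bounds[OF p, of m] m by auto
  then have sub: "Suc (label_231 q) \<le> k"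
    using l m last_conv_nth[of q] by (cases q) (auto simp: label_231_def)
  have lab: "label_231 (append_rank q e) = e" if "e \<le> k" for e
    using that by (simp add: label_231_def append_rank_def l)
  show "bij_betw label_231 {r \<in> Av (Suc k) [2, 3, 1]. prefix_flattening r k = q} {..Suc (label_231 q)}"
  proof (rule bij_betw_children[OF p])
    show "append_rank q e \<in> Av (Suc k) [2, 3, 1] \<longleftrightarrow> e \<in> {..Suc (label_231 q)}" if "e \<le> k" for e
      using append_rank_Av_231_iff[of q m e] q m that by simp
    show "{..Suc (label_231 q)} \<subseteq> {..k}" using sub by auto
    show "bij_betw (\<lambda>e. label_231 (append_rank q e)) {..Suc (label_231 q)} {..Suc (label_231 q)}"
      using lab sub by (intro bij_betw_cong[THEN iffD1, OF _ bij_betw_id]) auto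
  qed
next
  fix r k assume r: "r \<in> Av (Suc k) [2, 3, 1]"
  then have p: "r \<in> perms (Suc k)" by (simp add: Av_def)
  have "last r = r ! k" "length r = Suc k"
    using perms_length[OF p] last_conv_nth[of r] by (cases r; simp)+
  then show "label_231 r = 0 \<longleftrightarrow> r ! k = Suc k"
    using perms_nth_bounds[OF p, of k] by (auto simp: label_231_def)
qed (auto simp: label_231_def Av_1 intro: Av_perms Av_prefix_flattening)

section \<open>Skew-sum cuts and the generating rule for 132\<close>

text \<open>
  The positions at which \<open>r\<close> decomposes as a skew sum: each of the first \<open>l\<close> entries exceeds each later one.
\<close>

definition splits :: "nat list \<Rightarrow> nat set" where
  "splits r = {l. 1 \<le> l \<and> l < length r \<and> (\<forall>i<l. \<forall>j. l \<le> j \<and> j < length r \<longrightarrow> r ! j < r ! i)}"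

definition label_132 :: "nat list \<Rightarrow> nat" where
  "label_132 r = card (splits r)"

lemma finite_splits: "finite (splits r)"
  by (rule finite_subset[of _ "{..<length r}"]) (auto simp: splits_def)

text \<open>A cut puts the \<open>e\<close> largest values first: an entry before it exceeds all
  \<open>k - e\<close> entries behind it, an entry behind it exceeds only others behind it, and
  \<open>perms_nth_eq_card\<close> turns these counts into values. \<open>0\<close> and
  \<open>k\<close> are the trivial cuts.\<close>

lemma split_nth_greater_iff:
  assumes q: "q \<in> perms k" and e: "e \<in> insert 0 (insert k (splits q))" and i: "i < k"
  shows "k - e < q ! i \<longleftrightarrow> i < e"
proof -
  have l: "length q = k" by (rule perms_length[OF q])
  consider "e = 0" | "e = k" | "e < k" "\<And>i j. i < e \<Longrightarrow> e \<le> j \<Longrightarrow> j < k \<Longrightarrow> q ! j < q ! i"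
    using e l by (auto simp: splits_def)
  then show ?thesis
  proof cases
    case 3
    let ?S = "{j. j < k \<and> q ! j < q ! i}"
    have eq: "q ! i = Suc (card ?S)" by (rule perms_nth_eq_card[OF q i])
    show ?thesis
    proof
      assume "i < e"
      then have "{e..<k} \<subseteq> ?S" using 3 by auto
      then have "card {e..<k} \<le> card ?S" by (intro card_mono) auto
      then show "k - e < q ! i" using eq by simp
    next
      assume g: "k - e < q ! i"
      show "i < e"
      proof (rule ccontr)
        assume "\<not> i < e"
        then have "?S \<subseteq> {e..<k} - {i}" using 3 i by (auto simp: not_less) (meson less_asym not_less)
        then have "card ?S \<le> card ({e..<k} - {i})" by (intro card_mono) auto
        also have "\<dots> = k - e - 1" using \<open>\<not> i < e\<close> i by simp
        finally show False using g eq i \<open>\<not> i < e\<close> by linarith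
      qed
    qed
  qed (use perms_nth_bounds[OF q i] i in auto)
qed

lemma card_perms_greater:
  assumes q: "q \<in> perms k" and "e \<le> k"
  shows "card {i. i < k \<and> k - e < q ! i} = e"
proof -
  have "(!) q ` {i. i < k \<and> k - e < q ! i} = {k - e<..k}"
  proof (intro equalityI subsetI)
    fix v assume "v \<in> {k - e<..k}"
    then show "v \<in> (!) q ` {i. i < k \<and> k - e < q ! i}"
      using perms_obtain_nth[OF q, of v] by (auto simp: Suc_le_eq One_nat_def)
  qed (use perms_nth_bounds[OF q] in auto)
  moreover have "inj_on ((!) q) {i. i < k \<and> k - e < q ! i}"
    using perms_nth_eq_iff[OF q] by (auto simp: inj_on_def)
  ultimately show ?thesis using card_image assms(2) by fastforce
qed

lemma down_closed_eq_lessThan_card: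
  fixes P :: "nat set"
  assumes "finite P" "\<And>i j. i < j \<Longrightarrow> j \<in> P \<Longrightarrow> i \<in> P"
  shows "P = {..<card P}"
proof (cases "P = {}")
  case False
  then have "Max P \<in> P" by (rule Max_in[OF assms(1)])
  have "P = {..Max P}"
  proof (intro equalityI subsetI)
    fix i assume "i \<in> {..Max P}"
    then show "i \<in> P" using \<open>Max P \<in> P\<close> assms(2)[of i "Max P"] by (cases "i = Max P") auto
  qed (simp add: assms(1))
  then show ?thesis by (metis card_lessThan lessThan_Suc_atMost)
qed simp

text \<open>A new 132 ends in the appended entry, preceded by an entry at most \<open>k - e\<close>
  and a later one above \<open>k - e\<close>. Avoiding this means that the \<open>e\<close> large
  entries come first, so that \<open>e\<close> is a possibly trivial cut.\<close>

lemma append_rank_Av_132_iff: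
  assumes "q \<in> Av k [1, 3, 2]" "e \<le> k"
  shows "append_rank q e \<in> Av (Suc k) [1, 3, 2] \<longleftrightarrow> e \<in> insert 0 (insert k (splits q))"
proof -
  have q: "q \<in> perms k"
    and av: "\<And>i j l. i < j \<Longrightarrow> j < l \<Longrightarrow> l < k \<Longrightarrow> \<not> (q ! i < q ! l \<and> q ! l < q ! j)"
    using assms(1) unfolding Av_132_iff by auto
  have l: "length q = k" by (rule perms_length[OF q])
  have "append_rank q e \<in> Av (Suc k) [1, 3, 2] \<longleftrightarrow>
      (\<forall>i j l. i < j \<and> j < l \<and> l < Suc k \<longrightarrow>
        \<not> (append_rank q e ! i < append_rank q e ! l \<and> append_rank q e ! l < append_rank q e ! j))"
    unfolding Av_132_iff using append_rank_perms[OF q assms(2)] by simp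
  also have "\<dots> \<longleftrightarrow> (\<forall>i j. i < j \<and> j < k \<longrightarrow>
      \<not> (append_rank q e ! i < append_rank q e ! k \<and> append_rank q e ! k < append_rank q e ! j))"
    (is "_ \<longleftrightarrow> ?R")
  proof (intro iffI allI impI)
    fix i j l assume r: ?R and *: "i < j \<and> j < l \<and> l < Suc k"
    show "\<not> (append_rank q e ! i < append_rank q e ! l \<and> append_rank q e ! l < append_rank q e ! j)"
      using r * av[of i j l] append_rank_nth_less_iff[OF q] by (cases "l = k") auto
  qed auto
  also have "\<dots> \<longleftrightarrow> (\<forall>i j. i < j \<and> j < k \<longrightarrow> \<not> (q ! i \<le> k - e \<and> k - e < q ! j))"
    using append_rank_last_less_nth_iff[OF q _ assms(2)] append_rank_nth_less_last_iff[OF q _ assms(2)]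
    by (intro all_cong1 imp_cong refl) auto
  also have "\<dots> \<longleftrightarrow> e \<in> insert 0 (insert k (splits q))"
  proof
    assume a: "\<forall>i j. i < j \<and> j < k \<longrightarrow> \<not> (q ! i \<le> k - e \<and> k - e < q ! j)"
    let ?P = "{i. i < k \<and> k - e < q ! i}"
    have "i \<in> ?P" if "i < j" "j \<in> ?P" for i j using that a by (auto simp: not_le)
    \<comment> \<open>The positions of the large values are closed downwards, hence an initial
      segment, and its length is \<open>e\<close>.\<close>
    then have "?P = {..<card ?P}" by (intro down_closed_eq_lessThan_card) auto
    then have P: "?P = {..<e}" using card_perms_greater[OF q assms(2)] by simp
    have "q ! j < q ! i" if "i < e" "e \<le> j" "j < k" for i j
    proof -
      have "i \<in> ?P" "j \<notin> ?P" using P that by auto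
      with that show ?thesis by auto
    qed
    then show "e \<in> insert 0 (insert k (splits q))"
      using assms(2) l by (auto simp: splits_def Suc_le_eq One_nat_def)
  next
    assume e: "e \<in> insert 0 (insert k (splits q))"
    show "\<forall>i j. i < j \<and> j < k \<longrightarrow> \<not> (q ! i \<le> k - e \<and> k - e < q ! j)"
    proof (intro allI impI notI; elim conjE)
      fix i j assume "i < j" "j < k" "q ! i \<le> k - e" "k - e < q ! j"
      then show False
        using split_nth_greater_iff[OF q e, of i] split_nth_greater_iff[OF q e, of j] by simp
    qed
  qed
  finally show ?thesis .
qed

text \<open>A cut of the extended permutation is a cut of \<open>q\<close> or lies just before the
  new entry, at \<open>k\<close>. The new entry is below exactly the first \<open>e\<close> entries,
  so the cuts up to \<open>e\<close> survive.\<close>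

lemma splits_append_rank:
  assumes q: "q \<in> perms k" and "k \<ge> 1" and e: "e \<in> insert 0 (insert k (splits q))"
  shows "splits (append_rank q e) = {l \<in> insert k (splits q). l \<le> e}"
proof -
  have l: "length q = k" by (rule perms_length[OF q])
  have ek: "e \<le> k" using e l by (auto simp: splits_def)
  have la: "length (append_rank q e) = Suc k" by (rule perms_length[OF append_rank_perms[OF q ek]])
  have last: "append_rank q e ! k < append_rank q e ! i \<longleftrightarrow> i < e" if "i < k" for i
    using append_rank_last_less_nth_iff[OF q that ek] split_nth_greater_iff[OF q e that] by simp
  have "s \<in> splits (append_rank q e) \<longleftrightarrow> s \<in> insert k (splits q) \<and> s \<le> e" for s
  proof -
    have "s \<in> splits (append_rank q e) \<longleftrightarrow> 1 \<le> s \<and> s \<le> k \<and>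
        (\<forall>i<s. (\<forall>j. s \<le> j \<and> j < k \<longrightarrow> append_rank q e ! j < append_rank q e ! i) \<and>
          append_rank q e ! k < append_rank q e ! i)"
      unfolding splits_def la by (auto simp: less_Suc_eq)
    also have "\<dots> \<longleftrightarrow> 1 \<le> s \<and> s \<le> k \<and> (\<forall>i<s. (\<forall>j. s \<le> j \<and> j < k \<longrightarrow> q ! j < q ! i) \<and> i < e)"
      using last append_rank_nth_less_iff[OF q] by (metis less_le_trans)
    also have "\<dots> \<longleftrightarrow> 1 \<le> s \<and> s \<le> k \<and> (\<forall>i<s. \<forall>j. s \<le> j \<and> j < k \<longrightarrow> q ! j < q ! i) \<and> s \<le> e"
    proof -
      have "(\<forall>i<s. i < e) \<longleftrightarrow> s \<le> e" by (metis less_irrefl less_le_trans not_less)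
      then show ?thesis by blast
    qed
    also have "\<dots> \<longleftrightarrow> s \<in> insert k (splits q) \<and> s \<le> e"
      unfolding splits_def l using assms(2) by (auto simp: le_less)
    finally show ?thesis .
  qed
  then show ?thesis by blast
qed

text \<open>Counting the elements up to \<open>e\<close> numbers \<open>S\<close> increasingly from
  \<open>1\<close> to \<open>card S\<close>, and \<open>0\<close> receives \<open>0\<close>.\<close>

lemma bij_betw_card_le:
  fixes S :: "nat set"
  assumes "finite S" "0 \<notin> S"
  shows "bij_betw (\<lambda>e. card {l \<in> S. l \<le> e}) (insert 0 S) {..card S}"
proof -
  let ?f = "\<lambda>e. card {l \<in> S. l \<le> e}"
  have less: "?f d < ?f e" if "d < e" "e \<in> S" for d e
  proof (rule psubset_card_mono)
    have "e \<in> {l \<in> S. l \<le> e}" "e \<notin> {l \<in> S. l \<le> d}" using that by auto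
    moreover have "{l \<in> S. l \<le> d} \<subseteq> {l \<in> S. l \<le> e}" using that by auto
    ultimately show "{l \<in> S. l \<le> d} \<subset> {l \<in> S. l \<le> e}" by blast
  qed (use assms(1) in simp)
  have inj: "inj_on ?f (insert 0 S)"
  proof (rule linorder_inj_onI')
    fix d e assume "d \<in> insert 0 S" "e \<in> insert 0 S" "d < e"
    then have "?f d < ?f e" by (intro less) auto
    then show "?f d \<noteq> ?f e" by (rule less_imp_neq)
  qed
  have "?f ` insert 0 S \<subseteq> {..card S}" using assms(1) by (auto intro!: card_mono)
  then have "?f ` insert 0 S = {..card S}"
    using card_image[OF inj] assms by (intro card_subset_eq) auto
  with inj show ?thesis by (simp add: bij_betw_def)
qed

text \<open>The admissible ranks are \<open>0\<close> and the members of \<open>?S\<close>, and the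
  label of a child is the number of members of \<open>?S\<close> up to its rank. As
  \<open>?S\<close> has one element more than \<open>splits q\<close>, these labels fill the
  required range.\<close>

lemma label_tree_132: "label_tree (\<lambda>k. Av k [1, 3, 2]) label_132"
proof
  fix k q assume k: "k \<ge> 1" and q: "q \<in> Av k [1, 3, 2]"
  then have p: "q \<in> perms k" by (simp add: Av_def)
  have l: "length q = k" by (rule perms_length[OF p])
  let ?S = "insert k (splits q)"
  have card: "card ?S = Suc (label_132 q)"
    using finite_splits l by (simp add: label_132_def card_insert_if) (simp add: splits_def)
  show "bij_betw label_132 {r \<in> Av (Suc k) [1, 3, 2]. prefix_flattening r k = q} {..Suc (label_132 q)}"
  proof (rule bij_betw_children[OF p])
    show "append_rank q e \<in> Av (Suc k) [1, 3, 2] \<longleftrightarrow> e \<in> insert 0 ?S" if "e \<le> k" for e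
      by (rule append_rank_Av_132_iff[OF q that])
    show "insert 0 ?S \<subseteq> {..k}" using l by (auto simp: splits_def)
    have "bij_betw (\<lambda>e. card {s \<in> ?S. s \<le> e}) (insert 0 ?S) {..Suc (label_132 q)}"
      unfolding card[symmetric] using k finite_splits by (intro bij_betw_card_le) (auto simp: splits_def)
    then show "bij_betw (\<lambda>e. label_132 (append_rank q e)) (insert 0 ?S) {..Suc (label_132 q)}"
      by (rule bij_betw_cong[THEN iffD1, rotated])
        (simp add: label_132_def splits_append_rank[OF p k])
  qed
next
  fix r k assume r: "r \<in> Av (Suc k) [1, 3, 2]"
  then have p: "r \<in> perms (Suc k)" by (simp add: Av_def)
  show "label_132 r = 0 \<longleftrightarrow> r ! k = Suc k"
  proof (cases "k = 0")
    case True
    then show ?thesis using Av_1[of "[1, 3, 2]"] r by (auto simp: label_132_def splits_def One_nat_def)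
  next
    case False
    define q where "q = prefix_flattening r k"
    have qa: "q \<in> Av k [1, 3, 2]" unfolding q_def by (rule Av_prefix_flattening[OF r]) simp
    then have q: "q \<in> perms k" by (simp add: Av_def)
    obtain e where e: "e \<le> k" "r = append_rank q e" using perms_children[OF q p] q_def by metis
    then have act: "e \<in> insert 0 (insert k (splits q))"
      using append_rank_Av_132_iff[OF qa] r by blast
    have "label_132 r = 0 \<longleftrightarrow> {s \<in> insert k (splits q). s \<le> e} = {}"
      unfolding label_132_def e(2) using splits_append_rank[OF q _ act] finite_splits[of q] False
      by (simp add: One_nat_def Suc_le_eq)
    \<comment> \<open>A nonzero rank \<open>e\<close> is itself one of the surviving cuts, while all
      cuts are positive.\<close>
    also have "\<dots> \<longleftrightarrow> e = 0" using act False by (auto simp: splits_def)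
    also have "\<dots> \<longleftrightarrow> r ! k = Suc k" using append_rank_nth_last[OF q] e by auto
    finally show ?thesis .
  qed
qed (auto simp: label_132_def splits_def Av_1 intro: Av_perms Av_prefix_flattening)

theorem theorem3p8:
  fixes N :: nat
  assumes "N \<ge> 1"
  shows "\<exists>\<Phi>. bij_betw \<Phi> (perm_prefixes N (Av N [2, 3, 1])) (perm_prefixes N (Av N [1, 3, 2]))
    \<and> (\<forall>p \<in> perm_prefixes N (Av N [2, 3, 1]). \<forall>q \<in> perm_prefixes N (Av N [2, 3, 1]).
          is_prefix_flattening p q \<longleftrightarrow> is_prefix_flattening (\<Phi> p) (\<Phi> q))
    \<and> (\<forall>p \<in> perm_prefixes N (Av N [2, 3, 1]).
          strike N (Av N [1, 3, 2]) (\<Phi> p) = strike N (Av N [2, 3, 1]) p)"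
  by (rule label_tree_isomorphism[OF label_tree_231 label_tree_132])

end
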